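(* Let $P$ be a point not on the sides of $ABC$ or of its anticomplementary triangle. (a) $\gamma_P=\delta_P\circ\iota\circ\delta_P$. (b) The center $X$ of the map $\mathcal{S}=T_P\circ T_{P'}$ satisfies $\gamma_P(X)=Q'$. (c) The center $S$ of the map $\mathsf{M}=T_P\circ K^{-1}\circ T_{P'}$ satisfies $\delta_P(S)=\iota(Q')$.
   Context: We work in the Euclidean plane extended by its line at infinity $l_\infty$; affine maps are extended to $l_\infty$. $ABC$ is an ordinary non-degenerate triangle; its sides are the lines $BC, CA, AB$. $X_1X_2\cdot Y_1Y_2$ denotes the intersection of two lines. $K$ is the complement map (homothety with center the centroid $G$ and ratio $-1/2$); $K^{-1}(ABC)$ is the anticomplementary triangle. $\iota$ is the isotomic map, $(x:y:z)\mapsto(1/x:1/y:1/z)$ in barycentric coordinates, defined for points not on the sides of $ABC$. $P$ is a point (ordinary or infinite) not on the sides of $ABC$ or $K^{-1}(ABC)$; $P'=\iota(P)$, $Q=K(P')$, $Q'=K(P)$. $DEF$ is the cevian triangle of $P$ ($D=AP\cdot BC$, $E=BP\cdot CA$, $F=CP\cdot AB$) and $D_3E_3F_3$ is the cevian triangle of $P'$. $T_P$ and $T_{P'}$ are the affine maps taking $ABC$ to $DEF$ and to $D_3E_3F_3$, respectively (vertices in order). The maps $\mathcal{S}=T_P\circ T_{P'}$ and $\mathsf{M}=T_P\circ K^{-1}\circ T_{P'}$ are each a homothety or translation; the center is the fixed center of the homothety, respectively (for a translation) the infinite point in the direction of translation. The map $\delta_P$: for $Y\neq A,B,C$, with traces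 $D^*=AY\cdot BC$, $E^*=BY\cdot CA$, $F^*=CY\cdot AB$, the point $\delta_P(Y)$ is the common point of the lines $A\,T_P(D^* )$, $B\,T_P(E^* )$, $C\,T_P(F^* )$ (which are concurrent). Generalized isogonal map $\gamma_P$: let $h_a$ be the affine reflection about the line $AQ$ in the direction of $EF$ (i.e. $h_a(X)=X'$ with $XX'\parallel EF$ and the midpoint of $XX'$ on $AQ$), $h_b$ the affine reflection about $BQ$ in the direction $DF$, and $h_c$ the affine reflection about $CQ$ in the direction $DE$. For $X\neq A,B,C$, $\gamma_P(X)$ is the common point of the lines $Ah_a(X),Bh_b(X),Ch_c(X)$ (which are concurrent). The equality in (a) is an equality of maps on the points not lying on the sides of $ABC$ (where all maps involved are defined). *)

theory Defs
  imports "HOL-Analysis.Analysis"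
begin

text \<open>
  The extended Euclidean plane is modelled as the projective completion of the plane:
  its points are the one-dimensional subspaces of \<open>(real^2) \<times> real\<close>. The ordinary point \<open>p\<close> is the
  subspace spanned by \<open>(p, 1)\<close>, and the infinite point in the direction \<open>v \<noteq> 0\<close> is the one spanned
  by \<open>(v, 0)\<close>. Lines are two-dimensional subspaces (the line at infinity is \<open>UNIV \<times> {0}\<close>),
  incidence is inclusion, the line through two distinct points is the span of their union, and the
  point common to two distinct lines is their intersection.
\<close>

type_synonym plane = "real^2"
type_synonym xset = "(plane \<times> real) set"

definition xpoint :: "xset \<Rightarrow> bool" where
  "xpoint X \<longleftrightarrow> subspace X \<and> dim X = 1"

definition ordp :: "plane \<Rightarrow> xset" where
  "ordp p = span {(p, 1)}"

definition infp :: "plane \<Rightarrow> xset" where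
  "infp v = span {(v, 0)}"

definition join :: "xset \<Rightarrow> xset \<Rightarrow> xset" where
  "join X Y = span (X \<union> Y)"

definition meet :: "xset \<Rightarrow> xset \<Rightarrow> xset" where
  "meet l m = l \<inter> m"

definition common_point :: "xset \<Rightarrow> xset \<Rightarrow> xset \<Rightarrow> xset" where
  "common_point l m n = (THE Z. xpoint Z \<and> Z \<subseteq> l \<and> Z \<subseteq> m \<and> Z \<subseteq> n)"

definition on_sides :: "plane \<Rightarrow> plane \<Rightarrow> plane \<Rightarrow> xset \<Rightarrow> bool" where
  "on_sides A B C X \<longleftrightarrow>
     X \<subseteq> join (ordp B) (ordp C) \<or> X \<subseteq> join (ordp C) (ordp A) \<or> X \<subseteq> join (ordp A) (ordp B)"


definition affine_map :: "(plane \<Rightarrow> plane) \<Rightarrow> bool" where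
  "affine_map f \<longleftrightarrow> (\<exists>L c. linear L \<and> f = (\<lambda>x. L x + c))"

text \<open>
  The extension of an affine map \<open>f\<close> to the line at infinity: \<open>(p, 1)\<close> is sent to \<open>(f p, 1)\<close>,
  and \<open>(v, 0)\<close> to \<open>(L v, 0)\<close>, where \<open>L\<close> is the linear part of \<open>f\<close>. It is only meaningful for
  affine bijections.
\<close>

definition ext :: "(plane \<Rightarrow> plane) \<Rightarrow> xset \<Rightarrow> xset" where
  "ext f X = (\<lambda>(v, t). (f v - f 0 + t *\<^sub>R f 0, t)) ` X"

definition homothety :: "plane \<Rightarrow> real \<Rightarrow> plane \<Rightarrow> plane" where
  "homothety c k X = c + k *\<^sub>R (X - c)"

text \<open>The identity counts neither as a homothety nor as a translation, having no definite center.\<close>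

definition center :: "(plane \<Rightarrow> plane) \<Rightarrow> xset" where
  "center f = (THE X.
     (\<exists>c k. k \<noteq> 0 \<and> k \<noteq> 1 \<and> f = homothety c k \<and> X = ordp c) \<or>
     (\<exists>v. v \<noteq> 0 \<and> f = (\<lambda>Y. Y + v) \<and> X = infp v))"

text \<open>
  The affine reflection about the line \<open>l\<close> in the direction of the line \<open>m\<close>, on ordinary points.
  The infinite point of \<open>m\<close> consists of the vectors \<open>(v, 0)\<close> of \<open>m\<close>, so the first conjunct says
  that \<open>X X'\<close> is parallel to \<open>m\<close> (or that \<open>X' = X\<close>).
\<close>

definition affine_reflection :: "xset \<Rightarrow> xset \<Rightarrow> plane \<Rightarrow> plane" where
  "affine_reflection l m X = (THE X'. (X' - X, 0) \<in> m \<and> ordp (midpoint X X') \<subseteq> l)"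


definition complement :: "plane \<Rightarrow> plane \<Rightarrow> plane \<Rightarrow> plane \<Rightarrow> plane" where
  "complement A B C = homothety ((1/3) *\<^sub>R (A + B + C)) (-1/2)"

definition on_anticomplementary_sides :: "plane \<Rightarrow> plane \<Rightarrow> plane \<Rightarrow> xset \<Rightarrow> bool" where
  "on_anticomplementary_sides A B C X \<longleftrightarrow>
     (let K' = inv (complement A B C) in on_sides (K' A) (K' B) (K' C) X)"

text \<open>The point with homogeneous barycentric coordinates \<open>(x : y : z)\<close>; it is infinite iff
  \<open>x + y + z = 0\<close>.\<close>

definition barycentric :: "plane \<Rightarrow> plane \<Rightarrow> plane \<Rightarrow> real \<Rightarrow> real \<Rightarrow> real \<Rightarrow> xset" where
  "barycentric A B C x y z = span {(x *\<^sub>R A + y *\<^sub>R B + z *\<^sub>R C, x + y + z)}"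

definition isotomic :: "plane \<Rightarrow> plane \<Rightarrow> plane \<Rightarrow> xset \<Rightarrow> xset" where
  "isotomic A B C X = (THE Y. \<exists>x y z. x \<noteq> 0 \<and> y \<noteq> 0 \<and> z \<noteq> 0 \<and>
     X = barycentric A B C x y z \<and> Y = barycentric A B C (1/x) (1/y) (1/z))"

text \<open>The trace on \<open>BC\<close> of the cevian through \<open>A\<close>; the other traces are obtained by permuting the
  vertices cyclically.\<close>

definition cevian_trace :: "plane \<Rightarrow> plane \<Rightarrow> plane \<Rightarrow> xset \<Rightarrow> xset" where
  "cevian_trace A B C X = meet (join (ordp A) X) (join (ordp B) (ordp C))"

definition cevian_map :: "plane \<Rightarrow> plane \<Rightarrow> plane \<Rightarrow> xset \<Rightarrow> plane \<Rightarrow> plane" where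
  "cevian_map A B C P = (THE f. affine_map f \<and>
     ordp (f A) = cevian_trace A B C P \<and> ordp (f B) = cevian_trace B C A P \<and> ordp (f C) = cevian_trace C A B P)"

definition delta :: "plane \<Rightarrow> plane \<Rightarrow> plane \<Rightarrow> xset \<Rightarrow> xset \<Rightarrow> xset" where
  "delta A B C P Y =
     (let T = ext (cevian_map A B C P) in
      common_point (join (ordp A) (T (cevian_trace A B C Y)))
                   (join (ordp B) (T (cevian_trace B C A Y)))
                   (join (ordp C) (T (cevian_trace C A B Y))))"

definition gamma :: "plane \<Rightarrow> plane \<Rightarrow> plane \<Rightarrow> xset \<Rightarrow> xset \<Rightarrow> xset" where
  "gamma A B C P X =
     (let Q = ext (complement A B C) (isotomic A B C P);
          D = cevian_trace A B C P; E = cevian_trace B C A P; F = cevian_trace C A B P;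
          ha = ext (affine_reflection (join (ordp A) Q) (join E F));
          hb = ext (affine_reflection (join (ordp B) Q) (join D F));
          hc = ext (affine_reflection (join (ordp C) Q) (join D E))
      in common_point (join (ordp A) (ha X)) (join (ordp B) (hb X)) (join (ordp C) (hc X)))"

end

theory Submission
  imports Defs
begin

text \<open>
  In barycentric coordinates with respect to \<open>ABC\<close> every map involved becomes an explicit rational
  map. Let \<open>P = (p : q : r)\<close>, and put \<open>a = p (q + r)\<close>, \<open>b = q (r + p)\<close>, \<open>c = r (p + q)\<close>, which are
  the coordinates of \<open>Q\<close>. The hypotheses on \<open>P\<close> say exactly that \<open>p\<close>, \<open>q\<close>, \<open>r\<close> and
  \<open>q + r\<close>, \<open>r + p\<close>, \<open>p + q\<close> are nonzero.

  The image under \<open>T\<^sub>P\<close> of the trace \<open>(0 : y : z)\<close> has last two coordinates in the ratio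
  \<open>b / y : c / z\<close>; hence \<open>\<delta>\<^sub>P\<close> is the map \<open>(x : y : z) \<mapsto> (a / x : b / y : c / z)\<close>
  (\<open>delta_barycentric\<close>). The reflection \<open>h\<^sub>a\<close> fixes the direction \<open>(b, c)\<close> of \<open>AQ\<close> seen from \<open>A\<close>
  and negates the direction \<open>(b, -c)\<close> of \<open>EF\<close>, so it turns the ratio \<open>y : z\<close> into
  \<open>b\<^sup>2 / y : c\<^sup>2 / z\<close>, and \<open>\<gamma>\<^sub>P\<close> is \<open>(x : y : z) \<mapsto> (a\<^sup>2 / x : b\<^sup>2 / y : c\<^sup>2 / z)\<close>
  (\<open>gamma_barycentric\<close>). As \<open>\<iota>\<close> inverts each coordinate, part (a) follows at once.

  For (b) and (c), let \<open>N = (q + r) (r + p) (p + q)\<close>. Evaluating the two composites at the vertices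
  shows that they have the form \<open>Y \<mapsto> k Y + w\<close>, with \<open>k = 2 p q r / N\<close> for \<open>\<S>\<close> and
  \<open>k = -4 p q r / N\<close> for \<open>\<M>\<close>. The center of such a map is spanned by \<open>(w, 1 - k)\<close>, whether it is a
  homothety or a translation; this gives \<open>X = (p a : q b : r c)\<close> and
  \<open>S = (a (q + r) : b (r + p) : c (p + q))\<close>
  (\<open>center_cevian_composition\<close>, \<open>center_cevian_complement_composition\<close>). Both points are off the sides,
  and applying \<open>\<gamma>\<^sub>P\<close> to \<open>X\<close> and \<open>\<delta>\<^sub>P\<close> to \<open>S\<close> gives \<open>(q + r : r + p : p + q)\<close>, which is
  \<open>Q' = K(P)\<close>, and its coordinatewise inverse.
\<close>

section \<open>Barycentric coordinates on the extended plane\<close>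

text \<open>
  All constructions are invariant under cyclic permutation of the vertices together with the
  coordinates. Facts about one vertex are therefore proved for \<open>A\<close> only; this lemma and the rotation
  lemmas for coordinates below transport them to \<open>B\<close> and \<open>C\<close>.
\<close>

lemma noncollinear_rotate:
  "\<not> collinear {A, B, C} \<Longrightarrow> \<not> collinear {B, C, A}"
  by (simp add: insert_commute)

text \<open>
  The spanning vector of a point with given barycentric coordinates. It is linear in the
  coordinates, which reduces incidence questions to linear equations in three unknowns.
\<close>

definition bvec :: "plane \<Rightarrow> plane \<Rightarrow> plane \<Rightarrow> real \<Rightarrow> real \<Rightarrow> real \<Rightarrow> plane \<times> real" where
  "bvec A B C x y z = (x *\<^sub>R A + y *\<^sub>R B + z *\<^sub>R C, x + y + z)"

lemma barycentric_span: "barycentric A B C x y z = span {bvec A B C x y z}"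
  by (simp add: barycentric_def bvec_def)

lemma bvec_rotate: "bvec B C A y z x = bvec A B C x y z"
  by (simp add: bvec_def algebra_simps)

lemma barycentric_rotate: "barycentric B C A y z x = barycentric A B C x y z"
  by (simp add: barycentric_span bvec_rotate)

lemma bvec_add: "bvec A B C x y z + bvec A B C x' y' z' = bvec A B C (x + x') (y + y') (z + z')"
  by (simp add: bvec_def algebra_simps)

lemma bvec_scaleR: "k *\<^sub>R bvec A B C x y z = bvec A B C (k * x) (k * y) (k * z)"
  by (simp add: bvec_def algebra_simps)

lemma bvec_eq_0_third:
  assumes nc: "\<not> collinear {A, B, C}" and eq: "bvec A B C x y z = 0"
  shows "z = 0"
proof (rule ccontr)
  assume z: "z \<noteq> 0"
  have s: "x = - y - z" and v: "x *\<^sub>R A + y *\<^sub>R B + z *\<^sub>R C = 0"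
    using eq by (auto simp: bvec_def zero_prod_def)
  \<comment> \<open>The relation, cleared of \<open>x\<close>, expresses \<open>C - A\<close> through \<open>B - A\<close>.\<close>
  have "z *\<^sub>R (C - A) = z *\<^sub>R ((- y / z) *\<^sub>R (B - A))"
    using v z unfolding s by (simp add: algebra_simps)
  then have C: "C - A = (- y / z) *\<^sub>R (B - A)"
    using z by (simp only: scaleR_cancel_left) simp
  then have "C = A + (- y / z) *\<^sub>R (B - A)"
    by (simp add: algebra_simps)
  moreover have "A = A + 0 *\<^sub>R (B - A)" "B = A + 1 *\<^sub>R (B - A)" by simp_all
  ultimately have "collinear {A, B, C}"
    unfolding collinear_alt by blast
  with nc show False by simp
qed

lemma bvec_eq_0_iff:
  assumes nc: "\<not> collinear {A, B, C}"
  shows "bvec A B C x y z = 0 \<longleftrightarrow> x = 0 \<and> y = 0 \<and> z = 0"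
proof
  assume 0: "bvec A B C x y z = 0"
  have "x = 0"
    using bvec_eq_0_third[OF noncollinear_rotate[OF nc], of y z x] 0 by (simp add: bvec_rotate)
  moreover have "y = 0"
    using bvec_eq_0_third[OF noncollinear_rotate[OF noncollinear_rotate[OF nc]], of z x y] 0
    by (simp add: bvec_rotate[of B C A] bvec_rotate[of A B C])
  ultimately show "x = 0 \<and> y = 0 \<and> z = 0"
    using bvec_eq_0_third[OF nc 0] by simp
qed (simp add: bvec_def zero_prod_def)

text \<open>
  Over a genuine triangle the coordinates of a vector are determined; together with
  \<open>bvec_exhaust\<close> this says that they form a linear coordinate system on the space whose lines
  through the origin are the points of the extended plane.
\<close>

lemma bvec_eq_iff:
  assumes nc: "\<not> collinear {A, B, C}"
  shows "bvec A B C x y z = bvec A B C x' y' z' \<longleftrightarrow> x = x' \<and> y = y' \<and> z = z'"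
proof -
  have "bvec A B C x y z = bvec A B C x' y' z' \<longleftrightarrow> bvec A B C (x - x') (y - y') (z - z') = 0"
    by (auto simp: bvec_def zero_prod_def algebra_simps)
  then show ?thesis by (simp add: bvec_eq_0_iff[OF nc])
qed

lemma linear_bvec: "linear (\<lambda>(x, y, z). bvec A B C x y z)"
  by (rule linearI) (auto simp: bvec_add bvec_scaleR)

lemma bij_bvec:
  assumes nc: "\<not> collinear {A, B, C}"
  shows "bij (\<lambda>(x, y, z). bvec A B C x y z)"
proof -
  have inj: "inj (\<lambda>(x, y, z). bvec A B C x y z)"
    by (auto intro!: injI simp: bvec_eq_iff[OF nc])
  moreover have "surj (\<lambda>(x, y, z). bvec A B C x y z)"
    by (rule linear_injective_imp_surjective[OF linear_bvec inj]) (simp add: dim_UNIV)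
  ultimately show ?thesis by (simp add: bij_def)
qed

text \<open>
  An injective linear map between spaces of the same dimension 3 is onto.
\<close>

lemma bvec_exhaust:
  assumes nc: "\<not> collinear {A, B, C}"
  obtains x y z where "g = bvec A B C x y z"
proof -
  obtain u where "g = (\<lambda>(x, y, z). bvec A B C x y z) u"
    using surjD[OF bij_is_surj[OF bij_bvec[OF nc]]] by blast
  then show ?thesis using that by (cases u) auto
qed

lemma xpoint_span:
  assumes "xpoint X" obtains g where "g \<noteq> 0" "X = span {g}"
proof -
  obtain Bs where Bs: "Bs \<subseteq> X" "independent Bs" "X \<subseteq> span Bs" "card Bs = dim X"
    using basis_exists by blast
  then obtain g where g: "Bs = {g}" using assms by (auto simp: xpoint_def card_1_singleton_iff)
  with Bs assms have "X = span {g}"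
    by (intro antisym span_minimal) (simp_all add: xpoint_def)
  moreover have "g \<noteq> 0" using Bs(2) g by (simp add: independent_insert)
  ultimately show ?thesis using that by blast
qed

lemma xpoint_span_iff: "xpoint (span {g}) \<longleftrightarrow> g \<noteq> 0"
  by (simp add: xpoint_def dim_span dim_singleton)

lemma xpoint_barycentric:
  assumes nc: "\<not> collinear {A, B, C}" and "xpoint X"
  obtains x y z where "X = barycentric A B C x y z" "\<not> (x = 0 \<and> y = 0 \<and> z = 0)"
proof -
  obtain g where g: "g \<noteq> 0" "X = span {g}" using assms(2) by (rule xpoint_span)
  obtain x y z where "g = bvec A B C x y z" by (rule bvec_exhaust[OF nc])
  with g show ?thesis using that[of x y z] bvec_eq_0_iff[OF nc] by (auto simp: barycentric_span)
qed

lemma span_scaled: "k \<noteq> 0 \<Longrightarrow> span {k *\<^sub>R g} = span {g::'a::real_vector}"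
proof (rule antisym)
  assume k: "k \<noteq> 0"
  then have "g = inverse k *\<^sub>R (k *\<^sub>R g)" by simp
  moreover have "inverse k *\<^sub>R (k *\<^sub>R g) \<in> span {k *\<^sub>R g}"
    by (intro span_scale span_base) simp
  ultimately have "g \<in> span {k *\<^sub>R g}" by simp
  then show "span {g} \<subseteq> span {k *\<^sub>R g}" by (simp add: span_minimal)
qed (simp add: span_minimal span_base span_scale)

lemma barycentric_scale:
  assumes "k \<noteq> 0"
  shows "barycentric A B C (k * x) (k * y) (k * z) = barycentric A B C x y z"
  using assms by (simp add: barycentric_span span_scaled flip: bvec_scaleR)

lemma bvec_in_barycentric:
  assumes nc: "\<not> collinear {A, B, C}"
  shows "bvec A B C u v w \<in> barycentric A B C x y z \<longleftrightarrow> (\<exists>k. u = k * x \<and> v = k * y \<and> w = k * z)"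
  by (simp only: barycentric_span span_singleton image_iff bvec_scaleR bvec_eq_iff[OF nc] bex_UNIV)

lemma bvec_in_join:
  assumes nc: "\<not> collinear {A, B, C}"
  shows "bvec A B C u v w \<in> join (barycentric A B C x y z) (barycentric A B C x' y' z')
    \<longleftrightarrow> (\<exists>s t. u = s * x + t * x' \<and> v = s * y + t * y' \<and> w = s * z + t * z')"
proof -
  have "join (barycentric A B C x y z) (barycentric A B C x' y' z')
     = {a + b |a b. a \<in> span {bvec A B C x y z} \<and> b \<in> span {bvec A B C x' y' z'}}"
    by (simp only: join_def barycentric_span span_Un span_span)
  then have "bvec A B C u v w \<in> join (barycentric A B C x y z) (barycentric A B C x' y' z') \<longleftrightarrow>
    (\<exists>s t. bvec A B C u v w = s *\<^sub>R bvec A B C x y z + t *\<^sub>R bvec A B C x' y' z')"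
    by (simp only: span_singleton) blast
  then show ?thesis
    by (simp only: bvec_scaleR bvec_add bvec_eq_iff[OF nc])
qed

section \<open>Incidence, cevians and the isotomic map\<close>

lemma ordp_eq_barycentric:
  "ordp A = barycentric A B C 1 0 0" "ordp B = barycentric A B C 0 1 0" "ordp C = barycentric A B C 0 0 1"
  by (simp_all add: ordp_def barycentric_def)

lemma bvec_set_eqI:
  assumes nc: "\<not> collinear {A, B, C}"
    and eq: "\<And>u v w. bvec A B C u v w \<in> X \<longleftrightarrow> bvec A B C u v w \<in> Y"
  shows "X = Y"
proof (rule set_eqI)
  fix g show "g \<in> X \<longleftrightarrow> g \<in> Y"
    using eq by (cases rule: bvec_exhaust[OF nc, of g]) simp
qed

lemma barycentric_subset_join_iff:
  "barycentric A B C x y z \<subseteq> join X Y \<longleftrightarrow> bvec A B C x y z \<in> join X Y"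
proof
  assume "bvec A B C x y z \<in> join X Y"
  then show "barycentric A B C x y z \<subseteq> join X Y"
    by (simp add: barycentric_span join_def span_minimal)
qed (auto simp: barycentric_span span_base)

text \<open>
  Points on a line through \<open>A\<close> have a constant ratio of second to third coordinate; this ratio
  is how every cevian is identified in what follows.
\<close>

lemma bvec_in_cevian:
  assumes nc: "\<not> collinear {A, B, C}" and yz: "y \<noteq> 0 \<or> z \<noteq> 0"
  shows "bvec A B C u v w \<in> join (ordp A) (barycentric A B C x y z) \<longleftrightarrow> v * z = w * y"
  unfolding ordp_eq_barycentric(1)[of A B C] bvec_in_join[OF nc]
proof
  assume eq: "v * z = w * y"
  define t where "t = (if y = 0 then w / z else v / y)"
  have "v = t * y \<and> w = t * z"
    using yz eq by (auto simp: t_def field_simps)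
  then show "\<exists>s t. u = s * 1 + t * x \<and> v = s * 0 + t * y \<and> w = s * 0 + t * z"
    by (intro exI[of _ "u - t * x"] exI[of _ t]) simp
qed auto

lemma bvec_in_side:
  assumes nc: "\<not> collinear {A, B, C}"
  shows "bvec A B C u v w \<in> join (ordp B) (ordp C) \<longleftrightarrow> u = 0"
  unfolding ordp_eq_barycentric(2)[of B A C] ordp_eq_barycentric(3)[of C A B] bvec_in_join[OF nc]
  by auto

lemma on_sides_barycentric:
  assumes nc: "\<not> collinear {A, B, C}"
  shows "on_sides A B C (barycentric A B C x y z) \<longleftrightarrow> x = 0 \<or> y = 0 \<or> z = 0"
proof -
  note nc' = noncollinear_rotate[OF nc] and nc'' = noncollinear_rotate[OF noncollinear_rotate[OF nc]]
  show ?thesis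
    unfolding on_sides_def barycentric_subset_join_iff
    using bvec_in_side[OF nc, of x y z] bvec_in_side[OF nc', of y z x] bvec_in_side[OF nc'', of z x y]
    by (simp add: bvec_rotate[of B C A] bvec_rotate[of A B C])
qed

lemma cevian_trace_barycentric:
  assumes nc: "\<not> collinear {A, B, C}" and yz: "y \<noteq> 0 \<or> z \<noteq> 0"
  shows "cevian_trace A B C (barycentric A B C x y z) = barycentric A B C 0 y z"
proof (rule bvec_set_eqI[OF nc])
  fix u v w
  have "bvec A B C u v w \<in> cevian_trace A B C (barycentric A B C x y z) \<longleftrightarrow> v * z = w * y \<and> u = 0"
    by (simp add: cevian_trace_def meet_def bvec_in_cevian[OF nc yz] bvec_in_side[OF nc])
  also have "\<dots> \<longleftrightarrow> (\<exists>k. u = k * 0 \<and> v = k * y \<and> w = k * z)"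
  proof
    assume *: "v * z = w * y \<and> u = 0"
    define k where "k = (if y = 0 then w / z else v / y)"
    have "u = k * 0 \<and> v = k * y \<and> w = k * z"
      using yz * by (auto simp: k_def field_simps)
    then show "\<exists>k. u = k * 0 \<and> v = k * y \<and> w = k * z" ..
  qed auto
  finally show "bvec A B C u v w \<in> cevian_trace A B C (barycentric A B C x y z) \<longleftrightarrow>
      bvec A B C u v w \<in> barycentric A B C 0 y z"
    by (simp only: bvec_in_barycentric[OF nc])
qed

text \<open>
  Only the ratio of the last two coordinates matters. The lemma serves to replace the cevian
  through an image point by the cevian through the point claimed to be common to all three lines.
\<close>

lemma cevian_line_eq:
  assumes nc: "\<not> collinear {A, B, C}" and "y \<noteq> 0" "z \<noteq> 0" "y1 \<noteq> 0" "y1 * z = z1 * y"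
  shows "join (ordp A) (barycentric A B C x1 y1 z1) = join (ordp A) (barycentric A B C x y z)"
proof (rule bvec_set_eqI[OF nc])
  fix u v w
  have z1: "z1 = y1 * z / y" using assms by (simp add: field_simps)
  have "v * z1 = w * y1 \<longleftrightarrow> y1 * (v * z) = y1 * (w * y)"
    using assms(2) by (simp add: z1 field_simps)
  then show "bvec A B C u v w \<in> join (ordp A) (barycentric A B C x1 y1 z1) \<longleftrightarrow>
      bvec A B C u v w \<in> join (ordp A) (barycentric A B C x y z)"
    using assms by (simp add: bvec_in_cevian[OF nc])
qed

text \<open>
  Off the sides the three cevians of a point are distinct lines, so they determine the point:
  two of the three constant ratios already fix the coordinates up to a factor.
\<close>

lemma common_point_cevians:
  assumes nc: "\<not> collinear {A, B, C}" and nz: "x \<noteq> 0" "y \<noteq> 0" "z \<noteq> 0"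
  shows "common_point (join (ordp A) (barycentric A B C x y z)) (join (ordp B) (barycentric A B C x y z))
    (join (ordp C) (barycentric A B C x y z)) = barycentric A B C x y z"
  unfolding common_point_def
proof (rule the_equality)
  let ?X = "barycentric A B C x y z"
  show "xpoint ?X \<and> ?X \<subseteq> join (ordp A) ?X \<and> ?X \<subseteq> join (ordp B) ?X \<and> ?X \<subseteq> join (ordp C) ?X"
    using nz by (auto simp: barycentric_span xpoint_span_iff bvec_eq_0_iff[OF nc] join_def span_base)
  fix Z assume Z: "xpoint Z \<and> Z \<subseteq> join (ordp A) ?X \<and> Z \<subseteq> join (ordp B) ?X \<and> Z \<subseteq> join (ordp C) ?X"
  then obtain u v w where Zb: "Z = barycentric A B C u v w" and uvw: "\<not> (u = 0 \<and> v = 0 \<and> w = 0)"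
    using xpoint_barycentric[OF nc] by blast
  note nc' = noncollinear_rotate[OF nc] and nc'' = noncollinear_rotate[OF noncollinear_rotate[OF nc]]
  have "v * z = w * y"
    using Z nz by (simp add: Zb barycentric_subset_join_iff bvec_in_cevian[OF nc])
  moreover have "w * x = u * z"
    using Z nz bvec_in_cevian[OF nc', of z x v w u y]
    by (simp add: Zb barycentric_subset_join_iff barycentric_rotate[of B C A] bvec_rotate[of B C A])
  moreover have "u * y = v * x"
    using Z nz bvec_in_cevian[OF nc'', of x y w u v z]
    by (simp add: Zb barycentric_subset_join_iff barycentric_rotate[of C A B] bvec_rotate[of C A B]
        barycentric_rotate[of B C A] bvec_rotate[of B C A])
  ultimately have "v = (u / x) * y" "w = (u / x) * z" "u = (u / x) * x" using nz by (simp_all add: field_simps)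
  moreover from this have "u / x \<noteq> 0" using uvw nz by auto
  ultimately show "Z = ?X" using barycentric_scale unfolding Zb by metis
qed

lemma barycentric_eq_iff:
  assumes nc: "\<not> collinear {A, B, C}" and "x \<noteq> 0"
  shows "barycentric A B C x y z = barycentric A B C x' y' z' \<longleftrightarrow>
    (\<exists>k. k \<noteq> 0 \<and> x' = k * x \<and> y' = k * y \<and> z' = k * z)"
proof
  assume eq: "barycentric A B C x y z = barycentric A B C x' y' z'"
  have "bvec A B C x' y' z' \<in> barycentric A B C x y z"
    unfolding eq by (simp add: barycentric_span span_base)
  moreover have "bvec A B C x y z \<in> barycentric A B C x' y' z'"
    unfolding eq[symmetric] by (simp add: barycentric_span span_base)
  ultimately show "\<exists>k. k \<noteq> 0 \<and> x' = k * x \<and> y' = k * y \<and> z' = k * z"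
    unfolding bvec_in_barycentric[OF nc] using assms(2) by auto
qed (auto simp: barycentric_scale)

text \<open>
  Rescaling the coordinates of a point rescales their reciprocals, so the choice of coordinates in
  the definition does not matter.
\<close>

lemma isotomic_barycentric:
  assumes nc: "\<not> collinear {A, B, C}" and nz: "x \<noteq> 0" "y \<noteq> 0" "z \<noteq> 0"
  shows "isotomic A B C (barycentric A B C x y z) = barycentric A B C (1/x) (1/y) (1/z)"
  unfolding isotomic_def
proof (rule the_equality)
  fix Y assume "\<exists>x' y' z'. x' \<noteq> 0 \<and> y' \<noteq> 0 \<and> z' \<noteq> 0 \<and>
     barycentric A B C x y z = barycentric A B C x' y' z' \<and> Y = barycentric A B C (1/x') (1/y') (1/z')"
  then obtain k where k: "k \<noteq> 0" "Y = barycentric A B C (1/(k*x)) (1/(k*y)) (1/(k*z))"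
    by (auto simp: barycentric_eq_iff[OF nc nz(1)])
  then show "Y = barycentric A B C (1/x) (1/y) (1/z)"
    using barycentric_scale[of "1/k" A B C "1/x" "1/y" "1/z"] by simp
qed (use nz in blast)

section \<open>Affine maps\<close>

lemma affine_mapE:
  assumes "affine_map f" obtains L c where "linear L" "\<And>v. f v = L v + c"
  using assms by (auto simp: affine_map_def)

lemma affine_map_combination:
  assumes "affine_map f" "x + y + z = 1"
  shows "f (x *\<^sub>R A + y *\<^sub>R B + z *\<^sub>R C) = x *\<^sub>R f A + y *\<^sub>R f B + z *\<^sub>R f C"
proof -
  obtain L c where L: "linear L" "\<And>v. f v = L v + c" using assms(1) by (rule affine_mapE) blast
  have "c = (x + y + z) *\<^sub>R c" using assms(2) by simp
  then show ?thesis
    by (simp add: L(2) linear_add[OF L(1)] linear_scale[OF L(1)] algebra_simps)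
qed

lemma affine_map_combination2:
  assumes "affine_map f" "x + y = 1"
  shows "f (x *\<^sub>R A + y *\<^sub>R B) = x *\<^sub>R f A + y *\<^sub>R f B"
  using affine_map_combination[OF assms(1), of x y 0 A B A] assms(2) by simp

lemma affine_map_comp:
  assumes "affine_map f" "affine_map g" shows "affine_map (f \<circ> g)"
proof -
  obtain L c L' c' where L: "linear L" "\<And>v. f v = L v + c" "linear L'" "\<And>v. g v = L' v + c'"
    using assms by (metis affine_mapE)
  have "f \<circ> g = (\<lambda>x. (L \<circ> L') x + (L c' + c))"
    by (auto simp: L(2,4) linear_add[OF L(1)])
  then show ?thesis unfolding affine_map_def using linear_compose[OF L(3,1)] by blast
qed

lemma affine_map_scale_add: "affine_map (\<lambda>Y. k *\<^sub>R Y + w)"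
  unfolding affine_map_def by (intro exI[of _ "\<lambda>Y. k *\<^sub>R Y"] exI[of _ w]) (auto intro: linearI simp: algebra_simps)

text \<open>
  An affine map preserves barycentric coordinates when the reference triangle is moved along;
  homogenised, this also covers infinite points.
\<close>

lemma ext_barycentric:
  assumes "affine_map f"
  shows "ext f (barycentric A B C x y z) = barycentric (f A) (f B) (f C) x y z"
proof -
  obtain L c where L: "linear L" "\<And>v. f v = L v + c" using assms by (rule affine_mapE) blast
  let ?g = "\<lambda>(v, t). (L v + t *\<^sub>R c, t)"
  have lin: "linear ?g"
    by (rule linearI) (auto simp: linear_add[OF L(1)] linear_scale[OF L(1)] algebra_simps)
  have "ext f X = ?g ` X" for X
    by (simp add: ext_def L(2) linear_0[OF L(1)])
  moreover have "?g (bvec A B C x y z) = bvec (f A) (f B) (f C) x y z"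
    by (simp add: bvec_def L(2) linear_add[OF L(1)] linear_scale[OF L(1)] algebra_simps)
  ultimately show ?thesis
    using linear_span_image[OF lin, of "{bvec A B C x y z}"] by (simp add: barycentric_span)
qed

lemma affine_coordinates:
  fixes A B C X :: plane
  assumes nc: "\<not> collinear {A, B, C}"
  obtains x y z where "X = x *\<^sub>R A + y *\<^sub>R B + z *\<^sub>R C" "x + y + z = 1"
proof -
  obtain x y z where "(X, 1) = bvec A B C x y z" by (rule bvec_exhaust[OF nc])
  then show ?thesis using that by (simp add: bvec_def)
qed

lemma affine_map_eqI:
  assumes nc: "\<not> collinear {A, B, C}" and fg: "affine_map f" "affine_map g"
    and "f A = g A" "f B = g B" "f C = g C"
  shows "f = g"
proof
  fix X
  obtain x y z where "X = x *\<^sub>R A + y *\<^sub>R B + z *\<^sub>R C" "x + y + z = 1"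
    by (rule affine_coordinates[OF nc])
  then show "f X = g X" using assms by (simp add: affine_map_combination)
qed

text \<open>
  Read off barycentric coordinates and substitute the prescribed images for the vertices.
\<close>

lemma affine_map_exists:
  assumes nc: "\<not> collinear {A, B, C}"
  obtains f where "affine_map f" "f A = D" "f B = E" "f C = F"
proof -
  obtain g where g: "linear g" "g \<circ> (\<lambda>(x, y, z). bvec A B C x y z) = id"
    using linear_injective_left_inverse[OF linear_bvec bij_is_inj[OF bij_bvec[OF nc]]] by blast
  have gb: "g (bvec A B C x y z) = (x, y, z)" for x y z
    using fun_cong[OF g(2), of "(x, y, z)"] by simp
  let ?h = "\<lambda>(x, y, z). x *\<^sub>R D + y *\<^sub>R E + z *\<^sub>R F"
  have h: "linear ?h" by (rule linearI) (auto simp: algebra_simps)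
  have hg: "linear (\<lambda>u. ?h (g u))"
    using linear_compose[OF g(1) h] by (simp only: o_def)
  define f where "f X = ?h (g (X, 1))" for X
  have l: "linear (\<lambda>v. ?h (g (v, 0)))"
    by (rule linear_compose[OF _ hg, unfolded o_def, of "\<lambda>v. (v, 0)"]) (auto intro: linearI)
  have "f = (\<lambda>v. ?h (g (v, 0)) + ?h (g (0, 1)))"
  proof
    fix v show "f v = ?h (g (v, 0)) + ?h (g (0, 1))"
      using linear_add[OF hg, of "(v, 0)" "(0, 1)"] by (simp add: f_def)
  qed
  then have "affine_map f" unfolding affine_map_def using l by blast
  moreover have "f A = D" "f B = E" "f C = F"
    using gb[of 1 0 0] gb[of 0 1 0] gb[of 0 0 1] by (simp_all add: f_def bvec_def)
  ultimately show ?thesis using that by blast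
qed

section \<open>Cevian triangles and the map delta\<close>

lemma ordp_inj: "ordp X = ordp Y \<longleftrightarrow> X = Y"
proof
  assume eq: "ordp X = ordp Y"
  have "(X, 1) \<in> ordp X" by (simp add: ordp_def span_base)
  then show "X = Y" unfolding eq by (auto simp: ordp_def span_singleton)
qed simp

text \<open>
  Coordinates of a point off the sides (no coordinate vanishes) and off the sides of the
  anticomplementary triangle, whose equations are \<open>q + r = 0\<close>, \<open>r + p = 0\<close> and \<open>p + q = 0\<close>.
  Such an equation says that a cevian is parallel to the opposite side, so for admissible
  coordinates the cevian triangle is ordinary.
\<close>

definition admissible :: "real \<Rightarrow> real \<Rightarrow> real \<Rightarrow> bool" where
  "admissible p q r \<longleftrightarrow> p \<noteq> 0 \<and> q \<noteq> 0 \<and> r \<noteq> 0 \<and> q + r \<noteq> 0 \<and> r + p \<noteq> 0 \<and> p + q \<noteq> 0"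

lemma admissible_rotate: "admissible p q r \<Longrightarrow> admissible q r p"
  by (auto simp: admissible_def)

text \<open>
  The isotomic conjugate is subject to the same conditions, because \<open>1/q + 1/r = (q + r)/(q r)\<close>;
  hence its cevian triangle is ordinary too.
\<close>

lemma admissible_inverse: "admissible p q r \<Longrightarrow> admissible (1/p) (1/q) (1/r)"
  by (auto simp: admissible_def field_simps)

lemma cevian_trace_ordinary:
  assumes nc: "\<not> collinear {A, B, C}" and "q + r \<noteq> 0"
  shows "cevian_trace A B C (barycentric A B C p q r) = ordp ((q / (q + r)) *\<^sub>R B + (r / (q + r)) *\<^sub>R C)"
proof -
  have "ordp ((q / (q + r)) *\<^sub>R B + (r / (q + r)) *\<^sub>R C) = barycentric A B C 0 (q / (q + r)) (r / (q + r))"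
    using assms(2) by (simp add: ordp_def barycentric_def add_divide_distrib[symmetric])
  also have "\<dots> = barycentric A B C 0 q r"
    using barycentric_scale[of "1 / (q + r)" A B C 0 q r] assms(2) by simp
  finally show ?thesis using assms(2) cevian_trace_barycentric[OF nc, of q r p] by fastforce
qed

lemma cevian_map_props:
  fixes p q r :: real
  assumes nc: "\<not> collinear {A, B, C}" and adm: "admissible p q r"
  defines "T \<equiv> cevian_map A B C (barycentric A B C p q r)"
  shows "affine_map T"
    and "T A = (q / (q + r)) *\<^sub>R B + (r / (q + r)) *\<^sub>R C"
    and "T B = (r / (r + p)) *\<^sub>R C + (p / (r + p)) *\<^sub>R A"
    and "T C = (p / (p + q)) *\<^sub>R A + (q / (p + q)) *\<^sub>R B"
proof -
  note nc' = noncollinear_rotate[OF nc] and nc'' = noncollinear_rotate[OF noncollinear_rotate[OF nc]]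
  let ?P = "barycentric A B C p q r"
  let ?D = "(q / (q + r)) *\<^sub>R B + (r / (q + r)) *\<^sub>R C" and ?E = "(r / (r + p)) *\<^sub>R C + (p / (r + p)) *\<^sub>R A"
    and ?F = "(p / (p + q)) *\<^sub>R A + (q / (p + q)) *\<^sub>R B"
  have tr: "cevian_trace A B C ?P = ordp ?D" "cevian_trace B C A ?P = ordp ?E" "cevian_trace C A B ?P = ordp ?F"
    using cevian_trace_ordinary[OF nc, of q r p] cevian_trace_ordinary[OF nc', of r p q]
      cevian_trace_ordinary[OF nc'', of p q r] adm
    by (simp_all add: admissible_def barycentric_rotate[of C A B] barycentric_rotate[of B C A])
  obtain f where f: "affine_map f" "f A = ?D" "f B = ?E" "f C = ?F"
    by (rule affine_map_exists[OF nc])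
  have "T = f"
    unfolding T_def cevian_map_def tr ordp_inj
    by (rule the_equality) (use f in \<open>auto intro: affine_map_eqI[OF nc]\<close>)
  with f show "affine_map T" "T A = ?D" "T B = ?E" "T C = ?F" by simp_all
qed

text \<open>
  In barycentric coordinates, the columns of the matrix of \<open>T\<^sub>P\<close> are the normalised coordinates of \<open>D\<close>, \<open>E\<close>, \<open>F\<close>.
\<close>

lemma ext_cevian_map:
  assumes nc: "\<not> collinear {A, B, C}" and adm: "admissible p q r"
  shows "ext (cevian_map A B C (barycentric A B C p q r)) (barycentric A B C x y z) =
    barycentric A B C (p * y / (r + p) + p * z / (p + q)) (q * z / (p + q) + q * x / (q + r))
      (r * x / (q + r) + r * y / (r + p))"
proof -
  let ?T = "cevian_map A B C (barycentric A B C p q r)"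
  have s: "q / (q + r) + r / (q + r) = 1" "r / (r + p) + p / (r + p) = 1" "p / (p + q) + q / (p + q) = 1"
    using adm by (simp_all add: admissible_def add_divide_distrib[symmetric])
  have "x + y + z = x * (q / (q + r) + r / (q + r)) + y * (r / (r + p) + p / (r + p)) + z * (p / (p + q) + q / (p + q))"
    by (simp only: s)
  then have "bvec (?T A) (?T B) (?T C) x y z = bvec A B C (p * y / (r + p) + p * z / (p + q)) (q * z / (p + q) + q * x / (q + r))
      (r * x / (q + r) + r * y / (r + p))"
    unfolding bvec_def cevian_map_props(2-4)[OF nc adm] by (simp add: algebra_simps)
  then show ?thesis
    unfolding ext_barycentric[OF cevian_map_props(1)[OF nc adm]] by (metis barycentric_span)
qed

lemma cevian_line_eq_B:
  assumes nc: "\<not> collinear {A, B, C}" and "x \<noteq> 0" "z \<noteq> 0" "z1 \<noteq> 0" "z1 * x = x1 * z"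
  shows "join (ordp B) (barycentric A B C x1 y1 z1) = join (ordp B) (barycentric A B C x y z)"
  using cevian_line_eq[OF noncollinear_rotate[OF nc] assms(3,2,4,5), of y1 y]
  by (simp add: barycentric_rotate[of B C A])

lemma cevian_line_eq_C:
  assumes nc: "\<not> collinear {A, B, C}" and "x \<noteq> 0" "y \<noteq> 0" "x1 \<noteq> 0" "x1 * y = y1 * x"
  shows "join (ordp C) (barycentric A B C x1 y1 z1) = join (ordp C) (barycentric A B C x y z)"
  using cevian_line_eq_B[OF noncollinear_rotate[OF nc] assms(3,2,4,5), of z1 z]
  by (simp add: barycentric_rotate[of B C A])

text \<open>
  The trace of the argument on \<open>BC\<close> is \<open>(0 : y : z)\<close>. Its image under \<open>T\<^sub>P\<close> lies on \<open>EF\<close>, with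
  last two coordinates \<open>q z / (p + q)\<close> and \<open>r y / (r + p)\<close>; their ratio is that of
  \<open>q (r + p) / y\<close> to \<open>r (p + q) / z\<close>. By symmetry the three lines meet at the stated point.
\<close>

lemma delta_barycentric:
  assumes nc: "\<not> collinear {A, B, C}" and adm: "admissible p q r" and nz: "x \<noteq> 0" "y \<noteq> 0" "z \<noteq> 0"
  shows "delta A B C (barycentric A B C p q r) (barycentric A B C x y z) =
    barycentric A B C (p * (q + r) / x) (q * (r + p) / y) (r * (p + q) / z)"
proof -
  note nc' = noncollinear_rotate[OF nc] and nc'' = noncollinear_rotate[OF noncollinear_rotate[OF nc]]
  let ?P = "barycentric A B C p q r" and ?Y = "barycentric A B C x y z"
  let ?Z = "barycentric A B C (p * (q + r) / x) (q * (r + p) / y) (r * (p + q) / z)"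
  let ?T = "ext (cevian_map A B C ?P)"
  note rot = barycentric_rotate[of C A B] barycentric_rotate[of B C A]
  have tr: "cevian_trace A B C ?Y = barycentric A B C 0 y z" "cevian_trace B C A ?Y = barycentric A B C x 0 z"
    "cevian_trace C A B ?Y = barycentric A B C x y 0"
    using cevian_trace_barycentric[OF nc, of y z x] cevian_trace_barycentric[OF nc', of z x y]
      cevian_trace_barycentric[OF nc'', of x y z] nz by (simp_all add: rot)
  note pqr = adm[unfolded admissible_def]
  have "join (ordp A) (?T (cevian_trace A B C ?Y)) = join (ordp A) ?Z"
    unfolding tr ext_cevian_map[OF nc adm]
    by (rule cevian_line_eq[OF nc]) (use nz pqr in simp_all)
  moreover have "join (ordp B) (?T (cevian_trace B C A ?Y)) = join (ordp B) ?Z"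
    unfolding tr ext_cevian_map[OF nc adm]
    by (rule cevian_line_eq_B[OF nc]) (use nz pqr in simp_all)
  moreover have "join (ordp C) (?T (cevian_trace C A B ?Y)) = join (ordp C) ?Z"
    unfolding tr ext_cevian_map[OF nc adm]
    by (rule cevian_line_eq_C[OF nc]) (use nz pqr in simp_all)
  ultimately show ?thesis
    unfolding delta_def Let_def using nz pqr by (simp add: common_point_cevians[OF nc])
qed

section \<open>The complement map and the anticomplementary triangle\<close>

lemma complement_alt: "complement A B C = (\<lambda>X. (-1/2) *\<^sub>R X + (1/2) *\<^sub>R (A + B + C))"
  by (rule ext) (simp add: complement_def homothety_def algebra_simps flip: scaleR_add_left)

lemma complement_rotate: "complement B C A = complement A B C"
  by (simp add: complement_alt algebra_simps)

lemma inv_complement: "inv (complement A B C) = (\<lambda>X. (-2) *\<^sub>R X + (A + B + C))"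
  by (rule inv_equality) (simp_all add: complement_alt algebra_simps)

lemma affine_map_complement: "affine_map (complement A B C)"
  unfolding complement_alt by (rule affine_map_scale_add)

text \<open>
  The complement map sends each vertex to the midpoint of the opposite side.
\<close>

lemma ext_complement_barycentric:
  "ext (complement A B C) (barycentric A B C x y z) = barycentric A B C (y + z) (z + x) (x + y)"
proof -
  let ?K = "complement A B C"
  have "bvec (?K A) (?K B) (?K C) x y z = bvec A B C ((1/2) * (y + z)) ((1/2) * (z + x)) ((1/2) * (x + y))"
    by (simp add: bvec_def complement_alt algebra_simps add_divide_distrib)
  then have "ext ?K (barycentric A B C x y z) = barycentric A B C ((1/2) * (y + z)) ((1/2) * (z + x)) ((1/2) * (x + y))"
    using ext_barycentric[of ?K] affine_map_complement by (metis barycentric_span)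
  then show ?thesis by (simp only: barycentric_scale)
qed

text \<open>
  The side through \<open>A\<close> of the anticomplementary triangle joins \<open>(1 : -1 : 1)\<close> and \<open>(1 : 1 : -1)\<close>,
  so its equation is \<open>y + z = 0\<close>.
\<close>

lemma on_anticomplementary_side:
  assumes nc: "\<not> collinear {A, B, C}"
  defines "K' \<equiv> inv (complement A B C)"
  assumes "y + z = 0"
  shows "barycentric A B C x y z \<subseteq> join (ordp (K' B)) (ordp (K' C))"
proof -
  have "ordp (K' B) = barycentric A B C 1 (-1) 1" "ordp (K' C) = barycentric A B C 1 1 (-1)"
    by (simp_all add: K'_def inv_complement ordp_def barycentric_def algebra_simps scaleR_2)
  moreover have "\<exists>s t. x = s * 1 + t * 1 \<and> y = s * (-1) + t * 1 \<and> z = s * 1 + t * (-1)"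
    by (rule exI[of _ "(x - y) / 2"], rule exI[of _ "(x + y) / 2"]) (use assms(3) in \<open>simp add: field_simps\<close>)
  ultimately show ?thesis
    by (simp only: barycentric_subset_join_iff bvec_in_join[OF nc])
qed

lemma admissible_coordinates:
  assumes nc: "\<not> collinear {A, B, C}" and P: "xpoint P" "\<not> on_sides A B C P" "\<not> on_anticomplementary_sides A B C P"
  obtains p q r where "P = barycentric A B C p q r" "admissible p q r"
proof -
  obtain p q r where P': "P = barycentric A B C p q r" by (rule xpoint_barycentric[OF nc P(1)])
  note nc' = noncollinear_rotate[OF nc] and nc'' = noncollinear_rotate[OF noncollinear_rotate[OF nc]]
  note K = complement_rotate[of C A B] complement_rotate[of B C A]
  have "q + r \<noteq> 0"
    using on_anticomplementary_side[OF nc, of q r p] P(3)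
    by (auto simp: P' on_anticomplementary_sides_def on_sides_def Let_def)
  moreover have "r + p \<noteq> 0"
    using on_anticomplementary_side[OF nc', of r p q] P(3)
    by (auto simp: P' on_anticomplementary_sides_def on_sides_def Let_def K barycentric_rotate[of B C A])
  moreover have "p + q \<noteq> 0"
    using on_anticomplementary_side[OF nc'', of p q r] P(3)
    by (auto simp: P' on_anticomplementary_sides_def on_sides_def Let_def K barycentric_rotate[of B C A] barycentric_rotate[of C A B])
  ultimately have "admissible p q r"
    using P(2) by (simp add: P' on_sides_barycentric[OF nc] admissible_def)
  with P' show ?thesis using that by blast
qed

section \<open>Centers of homotheties and translations\<close>

text \<open>
  Homotheties and translations are uniformly of the form \<open>Y \<mapsto> k Y + w\<close>, and their center is the
  point spanned by \<open>(w, 1 - k)\<close>: for \<open>k \<noteq> 1\<close> this is the fixed point \<open>w / (1 - k)\<close>, and for \<open>k = 1\<close> the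
  infinite point in the direction \<open>w\<close>. The excluded case is the identity, which has no center.
\<close>

lemma center_scale_add:
  assumes k: "k \<noteq> 0" and kw: "k = 1 \<Longrightarrow> w \<noteq> 0"
  shows "center (\<lambda>Y. k *\<^sub>R Y + w) = span {(w, 1 - k)}"
proof -
  have uniq: "k' = k \<and> w' = w" if "(\<lambda>Y. k *\<^sub>R Y + w) = (\<lambda>Y. k' *\<^sub>R Y + w')" for k' and w' :: plane
  proof -
    have e: "k *\<^sub>R Y + w = k' *\<^sub>R Y + w'" for Y using that by metis
    have "w' = w" using e[of 0] by simp
    moreover have "k = k'" using e[of "axis 1 1"] \<open>w' = w\<close> by (simp add: axis_eq_0_iff)
    ultimately show ?thesis by simp
  qed
  have homothety_alt: "homothety c j = (\<lambda>Y. j *\<^sub>R Y + (1 - j) *\<^sub>R c)" for c j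
    by (rule ext) (simp add: homothety_def algebra_simps)
  have ordp: "ordp c = span {((1 - j) *\<^sub>R c, 1 - j)}" if "j \<noteq> 1" for c :: plane and j
    using span_scaled[of "1 - j" "(c, 1::real)"] that by (simp add: ordp_def)
  show ?thesis
    unfolding center_def
  proof (rule the_equality)
    show "(\<exists>c j. j \<noteq> 0 \<and> j \<noteq> 1 \<and> (\<lambda>Y. k *\<^sub>R Y + w) = homothety c j \<and> span {(w, 1 - k)} = ordp c) \<or>
      (\<exists>v. v \<noteq> 0 \<and> (\<lambda>Y. k *\<^sub>R Y + w) = (\<lambda>Y. Y + v) \<and> span {(w, 1 - k)} = infp v)"
    proof (cases "k = 1")
      case True
      then show ?thesis using kw by (intro disjI2 exI[of _ w]) (simp add: infp_def)
    next
      case False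
      then show ?thesis using k
        by (intro disjI1 exI[of _ "(1 / (1 - k)) *\<^sub>R w"] exI[of _ k]) (simp add: homothety_alt ordp[of k])
    qed
  next
    fix X assume "(\<exists>c j. j \<noteq> 0 \<and> j \<noteq> 1 \<and> (\<lambda>Y. k *\<^sub>R Y + w) = homothety c j \<and> X = ordp c) \<or>
      (\<exists>v. v \<noteq> 0 \<and> (\<lambda>Y. k *\<^sub>R Y + w) = (\<lambda>Y. Y + v) \<and> X = infp v)"
    then show "X = span {(w, 1 - k)}"
    proof (elim disjE exE conjE)
      fix c j assume j: "j \<noteq> 1" "(\<lambda>Y. k *\<^sub>R Y + w) = homothety c j" and X: "X = ordp c"
      have "j = k" and w: "(1 - j) *\<^sub>R c = w"
        using uniq[OF j(2)[unfolded homothety_alt]] by blast+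
      then show ?thesis using ordp[OF j(1), of c] unfolding X by (simp only:)
    next
      fix v assume "(\<lambda>Y. k *\<^sub>R Y + w) = (\<lambda>Y. Y + v)" "X = infp v"
      then show ?thesis using uniq[of 1 v] by (simp add: infp_def)
    qed
  qed
qed

section \<open>The generalized isogonal map\<close>

text \<open>
  Intercept form of the line \<open>EF\<close>, which meets the sides through \<open>A\<close> in \<open>(p : 0 : r)\<close> and \<open>(p : q : 0)\<close>.
\<close>

lemma bvec_in_trace_line:
  assumes nc: "\<not> collinear {A, B, C}" and nz: "p \<noteq> 0" "q \<noteq> 0" "r \<noteq> 0"
  shows "bvec A B C u v w \<in> join (barycentric A B C p 0 r) (barycentric A B C p q 0) \<longleftrightarrow>
    u / p = v / q + w / r"
  unfolding bvec_in_join[OF nc]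
proof
  assume "u / p = v / q + w / r"
  then show "\<exists>s t. u = s * p + t * p \<and> v = s * 0 + t * q \<and> w = s * r + t * 0"
    using nz by (intro exI[of _ "w / r"] exI[of _ "v / q"]) (simp add: field_simps)
qed (use nz in \<open>auto simp: field_simps\<close>)

text \<open>
  With \<open>b = q (r + p)\<close> and \<open>c = r (p + q)\<close>, the line \<open>AQ\<close> has equation \<open>c y = b z\<close>, and the infinite
  point of \<open>EF\<close> has last two coordinates \<open>(b, -c)\<close> up to a factor. Seen from \<open>A\<close>, the reflection
  thus fixes \<open>(b, c)\<close> and negates \<open>(b, -c)\<close>, that is, it sends \<open>(y, z)\<close> to \<open>(b z / c, c y / b)\<close>.
  The first coordinate is then forced by the sum being 1.
\<close>

lemma affine_reflection_coordinates:
  fixes A B C :: plane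
  assumes nc: "\<not> collinear {A, B, C}" and adm: "admissible p q r" and sum: "x + y + z = 1"
  defines "b \<equiv> q * (r + p)" and "c \<equiv> r * (p + q)"
  shows "affine_reflection (join (ordp A) (barycentric A B C a b c))
      (join (barycentric A B C p 0 r) (barycentric A B C p q 0)) (x *\<^sub>R A + y *\<^sub>R B + z *\<^sub>R C) =
    (1 - b / c * z - c / b * y) *\<^sub>R A + (b / c * z) *\<^sub>R B + (c / b * y) *\<^sub>R C"
proof -
  let ?l = "join (ordp A) (barycentric A B C a b c)"
  let ?m = "join (barycentric A B C p 0 r) (barycentric A B C p q 0)"
  let ?X = "x *\<^sub>R A + y *\<^sub>R B + z *\<^sub>R C"
  note pqr = adm[unfolded admissible_def]
  have b: "b \<noteq> 0" and c: "c \<noteq> 0" using pqr by (simp_all add: b_def c_def)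
  \<comment> \<open>Being parallel to \<open>EF\<close> is orthogonality of the last two coordinates of the displacement to \<open>(c, b)\<close>.\<close>
  have direction: "(x' *\<^sub>R A + y' *\<^sub>R B + z' *\<^sub>R C - ?X, 0) \<in> ?m \<longleftrightarrow> (y' - y) * c + (z' - z) * b = 0"
    if s': "x' + y' + z' = 1" for x' y' z'
  proof -
    have "(x' *\<^sub>R A + y' *\<^sub>R B + z' *\<^sub>R C - ?X, 0) = bvec A B C (x' - x) (y' - y) (z' - z)"
      using s' sum by (simp add: bvec_def algebra_simps)
    moreover have "x' - x = - (y' - y) - (z' - z)" using s' sum by simp
    ultimately have "(x' *\<^sub>R A + y' *\<^sub>R B + z' *\<^sub>R C - ?X, 0) \<in> ?m \<longleftrightarrow>
        (- (y' - y) - (z' - z)) / p = (y' - y) / q + (z' - z) / r"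
      using pqr by (simp add: bvec_in_trace_line[OF nc])
    also have "\<dots> \<longleftrightarrow> (- (y' - y) - (z' - z)) * (q * r) = ((y' - y) * r + (z' - z) * q) * p"
      using pqr by (simp add: frac_eq_eq add_frac_eq)
    also have "\<dots> \<longleftrightarrow> (y' - y) * c + (z' - z) * b = 0"
    proof -
      have "((y' - y) * r + (z' - z) * q) * p - (- (y' - y) - (z' - z)) * (q * r) = (y' - y) * c + (z' - z) * b"
        by (simp add: b_def c_def algebra_simps)
      then show ?thesis by linarith
    qed
    finally show ?thesis .
  qed
  have midpoint: "ordp (midpoint ?X (x' *\<^sub>R A + y' *\<^sub>R B + z' *\<^sub>R C)) \<subseteq> ?l \<longleftrightarrow> (y + y') * c = (z + z') * b"
    if s': "x' + y' + z' = 1" for x' y' z'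
  proof -
    have "(x + x') / 2 + (y + y') / 2 + (z + z') / 2 = 1"
      using s' sum by argo
    then have "ordp (midpoint ?X (x' *\<^sub>R A + y' *\<^sub>R B + z' *\<^sub>R C)) =
        barycentric A B C ((x + x') / 2) ((y + y') / 2) ((z + z') / 2)"
      by (simp add: ordp_def barycentric_def midpoint_def algebra_simps add_divide_distrib)
    also have "\<dots> = barycentric A B C (x + x') (y + y') (z + z')"
      using barycentric_scale[of "1/2" A B C "x + x'" "y + y'" "z + z'"] by simp
    finally show ?thesis
      using b by (simp add: barycentric_subset_join_iff bvec_in_cevian[OF nc])
  qed
  show ?thesis
    unfolding affine_reflection_def
  proof (rule the_equality)
    have s: "(1 - b / c * z - c / b * y) + b / c * z + c / b * y = 1" by simp
    show "((1 - b / c * z - c / b * y) *\<^sub>R A + (b / c * z) *\<^sub>R B + (c / b * y) *\<^sub>R C - ?X, 0) \<in> ?m \<and>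
      ordp (midpoint ?X ((1 - b / c * z - c / b * y) *\<^sub>R A + (b / c * z) *\<^sub>R B + (c / b * y) *\<^sub>R C)) \<subseteq> ?l"
      unfolding direction[OF s] midpoint[OF s] using b c by (simp add: field_simps)
  next
    fix X' assume X': "(X' - ?X, 0) \<in> ?m \<and> ordp (midpoint ?X X') \<subseteq> ?l"
    obtain x' y' z' where X'_eq: "X' = x' *\<^sub>R A + y' *\<^sub>R B + z' *\<^sub>R C" and s': "x' + y' + z' = 1"
      by (rule affine_coordinates[OF nc])
    have "(y' - y) * c + (z' - z) * b = 0" "(y + y') * c = (z + z') * b"
      using X' direction[OF s'] midpoint[OF s'] by (simp_all add: X'_eq)
    then have "c * y' = b * z" "b * z' = c * y" by (simp_all add: algebra_simps)
    then have "y' = b / c * z" "z' = c / b * y" using b c by (simp_all add: field_simps)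
    moreover from this have "x' = 1 - b / c * z - c / b * y" using s' by simp
    ultimately show "X' = (1 - b / c * z - c / b * y) *\<^sub>R A + (b / c * z) *\<^sub>R B + (c / b * y) *\<^sub>R C"
      by (simp only: X'_eq)
  qed
qed

text \<open>
  The coordinate formula shows that the reflection agrees with the affine map having the same values
  at the vertices; being affine, it extends to infinite points by the homogenised formula.
\<close>

lemma ext_affine_reflection:
  fixes A B C :: plane
  assumes nc: "\<not> collinear {A, B, C}" and adm: "admissible p q r"
  defines "b \<equiv> q * (r + p)" and "c \<equiv> r * (p + q)"
  shows "ext (affine_reflection (join (ordp A) (barycentric A B C a b c))
      (join (barycentric A B C p 0 r) (barycentric A B C p q 0))) (barycentric A B C x y z) =
    barycentric A B C (x + y + z - b / c * z - c / b * y) (b / c * z) (c / b * y)"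
proof -
  let ?h = "affine_reflection (join (ordp A) (barycentric A B C a b c))
      (join (barycentric A B C p 0 r) (barycentric A B C p q 0))"
  have h: "?h (x *\<^sub>R A + y *\<^sub>R B + z *\<^sub>R C) =
      (1 - b / c * z - c / b * y) *\<^sub>R A + (b / c * z) *\<^sub>R B + (c / b * y) *\<^sub>R C" if "x + y + z = 1" for x y z
    using affine_reflection_coordinates[OF nc adm that] unfolding b_def c_def .
  have hA: "?h A = A" and hB: "?h B = (1 - c / b) *\<^sub>R A + (c / b) *\<^sub>R C"
    and hC: "?h C = (1 - b / c) *\<^sub>R A + (b / c) *\<^sub>R B"
    using h[of 1 0 0] h[of 0 1 0] h[of 0 0 1] by simp_all
  obtain f where f: "affine_map f" "f A = ?h A" "f B = ?h B" "f C = ?h C"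
    by (rule affine_map_exists[OF nc])
  have "?h = f"
  proof
    fix X
    obtain x y z where X: "X = x *\<^sub>R A + y *\<^sub>R B + z *\<^sub>R C" and s: "x + y + z = 1"
      by (rule affine_coordinates[OF nc])
    have x: "x = 1 - y - z" using s by simp
    show "?h X = f X"
      unfolding X h[OF s] affine_map_combination[OF f(1) s] f(2-4) hA hB hC
      unfolding x by (simp add: algebra_simps)
  qed
  then have "affine_map ?h" using f(1) by simp
  moreover have "bvec (?h A) (?h B) (?h C) x y z = bvec A B C (x + y + z - b / c * z - c / b * y) (b / c * z) (c / b * y)"
    unfolding hA hB hC by (simp add: bvec_def algebra_simps)
  ultimately show ?thesis
    by (metis ext_barycentric barycentric_span)
qed

text \<open>
  Reflection turns the ratio \<open>y : z\<close> into \<open>b\<^sup>2 / y : c\<^sup>2 / z\<close>, so the reflected cevian passes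
  through the point that is expected to be the generalized isogonal conjugate.
\<close>

lemma reflected_cevian:
  fixes A B C :: plane
  assumes nc: "\<not> collinear {A, B, C}" and adm: "admissible p q r" and nz: "x \<noteq> 0" "y \<noteq> 0" "z \<noteq> 0"
  shows "join (ordp A) (ext (affine_reflection
      (join (ordp A) (barycentric A B C (p * (q + r)) (q * (r + p)) (r * (p + q))))
      (join (barycentric A B C p 0 r) (barycentric A B C p q 0))) (barycentric A B C x y z)) =
    join (ordp A) (barycentric A B C ((p * (q + r))\<^sup>2 / x) ((q * (r + p))\<^sup>2 / y) ((r * (p + q))\<^sup>2 / z))"
proof -
  have eq: "b / c * z * (c\<^sup>2 / z) = c / b * y * (b\<^sup>2 / y)" if "b \<noteq> 0" "c \<noteq> 0" for b c :: real
    using that nz by (simp add: field_simps power2_eq_square)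
  show ?thesis
    unfolding ext_affine_reflection[OF nc adm]
    by (rule cevian_line_eq[OF nc _ _ _ eq]) (use adm nz in \<open>simp_all add: admissible_def\<close>)
qed

lemma join_commute: "join X Y = join Y X"
  by (simp add: join_def Un_commute)

lemma gamma_barycentric:
  assumes nc: "\<not> collinear {A, B, C}" and adm: "admissible p q r" and nz: "x \<noteq> 0" "y \<noteq> 0" "z \<noteq> 0"
  shows "gamma A B C (barycentric A B C p q r) (barycentric A B C x y z) =
    barycentric A B C ((p * (q + r))\<^sup>2 / x) ((q * (r + p))\<^sup>2 / y) ((r * (p + q))\<^sup>2 / z)"
proof -
  note nc' = noncollinear_rotate[OF nc] and nc'' = noncollinear_rotate[OF noncollinear_rotate[OF nc]]
  note adm' = admissible_rotate[OF adm] and adm'' = admissible_rotate[OF admissible_rotate[OF adm]]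
  note rot = barycentric_rotate[of C A B] barycentric_rotate[of B C A]
  note pqr = adm[unfolded admissible_def]
  let ?P = "barycentric A B C p q r"
  have "isotomic A B C ?P = barycentric A B C (1/p) (1/q) (1/r)"
    using isotomic_barycentric[OF nc] pqr by simp
  also have "\<dots> = barycentric A B C (q * r) (r * p) (p * q)"
    using barycentric_scale[of "p * q * r" A B C "1/p" "1/q" "1/r"] pqr by (simp add: mult.commute)
  finally have Q: "ext (complement A B C) (isotomic A B C ?P) =
      barycentric A B C (p * (q + r)) (q * (r + p)) (r * (p + q))"
    by (simp add: ext_complement_barycentric algebra_simps)
  have tr: "cevian_trace A B C ?P = barycentric A B C 0 q r" "cevian_trace B C A ?P = barycentric A B C p 0 r"
    "cevian_trace C A B ?P = barycentric A B C p q 0"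
    using cevian_trace_barycentric[OF nc, of q r p] cevian_trace_barycentric[OF nc', of r p q]
      cevian_trace_barycentric[OF nc'', of p q r] pqr by (simp_all add: rot)
  note lines = reflected_cevian[OF nc adm nz] reflected_cevian[OF nc' adm' nz(2,3,1), unfolded rot]
    reflected_cevian[OF nc'' adm'' nz(3,1,2), unfolded rot]
  show ?thesis
    unfolding gamma_def Let_def Q tr
      join_commute[of "barycentric A B C 0 q r" "barycentric A B C p q 0"]
    unfolding lines
    using nz pqr by (simp add: common_point_cevians[OF nc])
qed

section \<open>Composites of cevian maps\<close>

text \<open>
  Passing from \<open>P\<close> to its isotomic conjugate swaps the two weights of each trace.
\<close>

lemma cevian_map_isotomic_props:
  assumes nc: "\<not> collinear {A, B, C}" and adm: "admissible p q r"
  defines "T' \<equiv> cevian_map A B C (isotomic A B C (barycentric A B C p q r))"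
  shows "affine_map T'"
    and "T' A = (r / (q + r)) *\<^sub>R B + (q / (q + r)) *\<^sub>R C"
    and "T' B = (p / (r + p)) *\<^sub>R C + (r / (r + p)) *\<^sub>R A"
    and "T' C = (q / (p + q)) *\<^sub>R A + (p / (p + q)) *\<^sub>R B"
proof -
  note pqr = adm[unfolded admissible_def]
  have w: "(1/y) / (1/y + 1/z) = z / (y + z)" "(1/z) / (1/y + 1/z) = y / (y + z)"
    if "y \<noteq> 0" "z \<noteq> 0" "y + z \<noteq> 0" for y z :: real
    using that by (simp_all add: add_frac_eq add.commute)
  have T': "T' = cevian_map A B C (barycentric A B C (1/p) (1/q) (1/r))"
    unfolding T'_def using isotomic_barycentric[OF nc] pqr by simp
  note props = cevian_map_props[OF nc admissible_inverse[OF adm], folded T']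
  show "affine_map T'" by (rule props)
  show "T' A = (r / (q + r)) *\<^sub>R B + (q / (q + r)) *\<^sub>R C"
    using props(2) w[of q r] pqr by simp
  show "T' B = (p / (r + p)) *\<^sub>R C + (r / (r + p)) *\<^sub>R A"
    using props(3) w[of r p] pqr by simp
  show "T' C = (q / (p + q)) *\<^sub>R A + (p / (p + q)) *\<^sub>R B"
    using props(4) w[of p q] pqr by simp
qed

text \<open>
  The image of \<open>A\<close> under \<open>T\<^sub>P\<close> after the cevian map of the isotomic conjugate has the form \<open>k A + w\<close> where \<open>k\<close> and \<open>w\<close> are invariant under
  cyclic permutation. This symmetry is what makes the map a homothety or translation: the same \<open>k\<close>
  and \<open>w\<close> work at \<open>B\<close> and \<open>C\<close>.
\<close>

lemma cevian_composition_vertex: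
  fixes A B C :: plane
  assumes adm: "admissible p q r" and T: "affine_map T"
    and TB: "T B = (r / (r + p)) *\<^sub>R C + (p / (r + p)) *\<^sub>R A"
    and TC: "T C = (p / (p + q)) *\<^sub>R A + (q / (p + q)) *\<^sub>R B"
  defines "N \<equiv> (q + r) * (r + p) * (p + q)"
  shows "T ((r / (q + r)) *\<^sub>R B + (q / (q + r)) *\<^sub>R C) =
    (2 * p * q * r / N) *\<^sub>R A +
    ((p\<^sup>2 * (q + r) / N) *\<^sub>R A + (q\<^sup>2 * (r + p) / N) *\<^sub>R B + (r\<^sup>2 * (p + q) / N) *\<^sub>R C)"
proof -
  note pqr = adm[unfolded admissible_def]
  have "r / (q + r) + q / (q + r) = 1" using pqr by (simp add: add_divide_distrib[symmetric] add.commute)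
  then have "T ((r / (q + r)) *\<^sub>R B + (q / (q + r)) *\<^sub>R C) =
     (r / (q + r)) *\<^sub>R ((r / (r + p)) *\<^sub>R C + (p / (r + p)) *\<^sub>R A)
      + (q / (q + r)) *\<^sub>R ((p / (p + q)) *\<^sub>R A + (q / (p + q)) *\<^sub>R B)"
    by (simp only: affine_map_combination2[OF T] TB TC)
  also have "\<dots> = (r / (q + r) * (p / (r + p)) + q / (q + r) * (p / (p + q))) *\<^sub>R A
      + (q / (q + r) * (q / (p + q))) *\<^sub>R B + (r / (q + r) * (r / (r + p))) *\<^sub>R C"
    by (simp only: scaleR_add_right scaleR_add_left scaleR_scaleR ac_simps)
  also have "r / (q + r) * (p / (r + p)) + q / (q + r) * (p / (p + q)) = 2 * p * q * r / N + p\<^sup>2 * (q + r) / N"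
  proof -
    have "r / (q + r) * (p / (r + p)) = r * p * (p + q) / N" "q / (q + r) * (p / (p + q)) = q * p * (r + p) / N"
      using pqr by (simp_all add: N_def)
    then show ?thesis
      by (simp add: add_divide_distrib[symmetric]) (simp add: algebra_simps power2_eq_square)
  qed
  also have "q / (q + r) * (q / (p + q)) = q\<^sup>2 * (r + p) / N"
    using pqr by (simp add: N_def power2_eq_square)
  also have "r / (q + r) * (r / (r + p)) = r\<^sup>2 * (p + q) / N"
    using pqr by (simp add: N_def power2_eq_square)
  finally show ?thesis by (simp only: scaleR_add_left ac_simps)
qed

text \<open>
  Again the image of \<open>A\<close> is \<open>k A + w\<close> with cyclically symmetric \<open>k\<close> and \<open>w\<close>. The inverse complement
  sends the trace \<open>(r B + q C) / (q + r)\<close> to \<open>A + e (B - C)\<close> with \<open>e = (q - r) / (q + r)\<close>, hence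
  \<open>T\<^sub>P\<close> sends it on to \<open>D + e (E - F)\<close>.
\<close>

lemma cevian_composition_complement_vertex:
  fixes A B C :: plane
  assumes adm: "admissible p q r" and T: "affine_map T"
    and TA: "T A = (q / (q + r)) *\<^sub>R B + (r / (q + r)) *\<^sub>R C"
    and TB: "T B = (r / (r + p)) *\<^sub>R C + (p / (r + p)) *\<^sub>R A"
    and TC: "T C = (p / (p + q)) *\<^sub>R A + (q / (p + q)) *\<^sub>R B"
  defines "N \<equiv> (q + r) * (r + p) * (p + q)"
  shows "T (inv (complement A B C) ((r / (q + r)) *\<^sub>R B + (q / (q + r)) *\<^sub>R C)) =
    (- 4 * p * q * r / N) *\<^sub>R A +
    ((p * (q + r)\<^sup>2 / N) *\<^sub>R A + (q * (r + p)\<^sup>2 / N) *\<^sub>R B + (r * (p + q)\<^sup>2 / N) *\<^sub>R C)"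
proof -
  note pqr = adm[unfolded admissible_def]
  define e where "e = (q - r) / (q + r)"
  have e: "1 - 2 * (r / (q + r)) = e" "1 - 2 * (q / (q + r)) = - e"
    using pqr by (simp_all add: e_def field_simps)
  have "inv (complement A B C) ((r / (q + r)) *\<^sub>R B + (q / (q + r)) *\<^sub>R C) =
      1 *\<^sub>R A + (1 - 2 * (r / (q + r))) *\<^sub>R B + (1 - 2 * (q / (q + r))) *\<^sub>R C"
    by (simp add: inv_complement algebra_simps)
  then have "T (inv (complement A B C) ((r / (q + r)) *\<^sub>R B + (q / (q + r)) *\<^sub>R C)) =
      ((q / (q + r)) *\<^sub>R B + (r / (q + r)) *\<^sub>R C) + e *\<^sub>R ((r / (r + p)) *\<^sub>R C + (p / (r + p)) *\<^sub>R A)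
      + (- e) *\<^sub>R ((p / (p + q)) *\<^sub>R A + (q / (p + q)) *\<^sub>R B)"
    using affine_map_combination[OF T, of 1 e "- e" A B C] unfolding e by (simp only: TA TB TC) simp
  also have "\<dots> = (e * (p / (r + p)) - e * (p / (p + q))) *\<^sub>R A
      + (q / (q + r) - e * (q / (p + q))) *\<^sub>R B + (r / (q + r) + e * (r / (r + p))) *\<^sub>R C"
    by (simp add: algebra_simps)
  also have "e * (p / (r + p)) - e * (p / (p + q)) = - 4 * p * q * r / N + p * (q + r)\<^sup>2 / N"
  proof -
    have "e * (p / (r + p)) = (q - r) * p * (p + q) / N" "e * (p / (p + q)) = (q - r) * p * (r + p) / N"
      using pqr by (simp_all add: N_def e_def)
    then show ?thesis
      by (simp only: add_divide_distrib[symmetric] diff_divide_distrib[symmetric])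
         (simp add: algebra_simps power2_eq_square)
  qed
  also have "q / (q + r) - e * (q / (p + q)) = q * (r + p)\<^sup>2 / N"
  proof -
    have "q / (q + r) = q * (r + p) * (p + q) / N" "e * (q / (p + q)) = (q - r) * q * (r + p) / N"
      using pqr by (simp_all add: N_def e_def)
    then show ?thesis
      by (simp only: diff_divide_distrib[symmetric]) (simp add: algebra_simps power2_eq_square)
  qed
  also have "r / (q + r) + e * (r / (r + p)) = r * (p + q)\<^sup>2 / N"
  proof -
    have "r / (q + r) = r * (r + p) * (p + q) / N" "e * (r / (r + p)) = (q - r) * r * (p + q) / N"
      using pqr by (simp_all add: N_def e_def)
    then show ?thesis
      by (simp only: add_divide_distrib[symmetric]) (simp add: algebra_simps power2_eq_square)
  qed
  finally show ?thesis by (simp only: scaleR_add_left ac_simps)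
qed

text \<open>
  A map that acts as \<open>Y \<mapsto> (k / N) Y + w\<close> at the three vertices does so everywhere. The
  condition \<open>N - k = x + y + z\<close> says that \<open>w\<close> and \<open>1 - k / N\<close> together have coordinates proportional
  to \<open>(x : y : z)\<close>; it also excludes the identity, since \<open>x \<noteq> 0\<close> forces \<open>w \<noteq> 0\<close> when \<open>k = N\<close>.
\<close>

lemma center_barycentric:
  fixes A B C :: plane
  assumes nc: "\<not> collinear {A, B, C}" and f: "affine_map f" and k: "k \<noteq> 0" and N: "N \<noteq> 0"
    and x: "x \<noteq> 0" and sum: "N - k = x + y + z"
    and w: "w = (x / N) *\<^sub>R A + (y / N) *\<^sub>R B + (z / N) *\<^sub>R C"
    and "f A = (k / N) *\<^sub>R A + w" "f B = (k / N) *\<^sub>R B + w" "f C = (k / N) *\<^sub>R C + w"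
  shows "center f = barycentric A B C x y z"
proof -
  have f_eq: "f = (\<lambda>Y. (k / N) *\<^sub>R Y + w)"
    by (rule affine_map_eqI[OF nc f affine_map_scale_add]) (use assms in simp_all)
  have "x / N + y / N + z / N = (N - k) / N" by (simp add: sum add_divide_distrib)
  then have b: "(w, 1 - k / N) = bvec A B C (x / N) (y / N) (z / N)"
    using N by (simp add: bvec_def w diff_divide_distrib)
  then have "(w, 1 - k / N) \<noteq> 0" using x N by (simp add: bvec_eq_0_iff[OF nc])
  then have "center f = barycentric A B C (x / N) (y / N) (z / N)"
    unfolding f_eq barycentric_span b[symmetric] using k N
    by (intro center_scale_add) (auto simp: zero_prod_def)
  also have "\<dots> = barycentric A B C x y z"
    using barycentric_scale[of "1 / N" A B C x y z] N by simp
  finally show ?thesis .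
qed

lemma center_cevian_composition:
  assumes nc: "\<not> collinear {A, B, C}" and adm: "admissible p q r"
  defines "P \<equiv> barycentric A B C p q r"
  shows "center (cevian_map A B C P \<circ> cevian_map A B C (isotomic A B C P)) =
    barycentric A B C (p\<^sup>2 * (q + r)) (q\<^sup>2 * (r + p)) (r\<^sup>2 * (p + q))"
proof -
  note pqr = adm[unfolded admissible_def]
  note T = cevian_map_props[OF nc adm, folded P_def]
  note T' = cevian_map_isotomic_props[OF nc adm, folded P_def]
  let ?f = "cevian_map A B C P \<circ> cevian_map A B C (isotomic A B C P)"
  let ?N = "(q + r) * (r + p) * (p + q)"
  define w where "w = (p\<^sup>2 * (q + r) / ?N) *\<^sub>R A + (q\<^sup>2 * (r + p) / ?N) *\<^sub>R B + (r\<^sup>2 * (p + q) / ?N) *\<^sub>R C"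
  have N: "?N \<noteq> 0" using pqr by simp
  have k: "2 * p * q * r \<noteq> 0" and x: "p\<^sup>2 * (q + r) \<noteq> 0" using pqr by simp_all
  have sum: "?N - 2 * p * q * r = p\<^sup>2 * (q + r) + q\<^sup>2 * (r + p) + r\<^sup>2 * (p + q)"
    by (simp add: algebra_simps power2_eq_square)
  have fA: "?f A = (2 * p * q * r / ?N) *\<^sub>R A + w"
    using cevian_composition_vertex[OF adm T(1,3,4)]
    by (simp only: w_def o_apply T' ac_simps)
  have fB: "?f B = (2 * p * q * r / ?N) *\<^sub>R B + w"
    using cevian_composition_vertex[OF admissible_rotate[OF adm] T(1,4,2)]
    by (simp only: w_def o_apply T'  ac_simps)
  have fC: "?f C = (2 * p * q * r / ?N) *\<^sub>R C + w"
    using cevian_composition_vertex[OF admissible_rotate[OF admissible_rotate[OF adm]] T(1,2,3)]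
    by (simp only: w_def o_apply T'  ac_simps)
  show ?thesis
    by (rule center_barycentric[OF nc affine_map_comp[OF T(1) T'(1)] k N x sum w_def fA fB fC])
qed

lemma center_cevian_complement_composition:
  assumes nc: "\<not> collinear {A, B, C}" and adm: "admissible p q r"
  defines "P \<equiv> barycentric A B C p q r"
  shows "center (cevian_map A B C P \<circ> inv (complement A B C) \<circ> cevian_map A B C (isotomic A B C P)) =
    barycentric A B C (p * (q + r)\<^sup>2) (q * (r + p)\<^sup>2) (r * (p + q)\<^sup>2)"
proof -
  note pqr = adm[unfolded admissible_def]
  note T = cevian_map_props[OF nc adm, folded P_def]
  note T' = cevian_map_isotomic_props[OF nc adm, folded P_def]
  have K: "affine_map (inv (complement A B C))"
    unfolding inv_complement by (rule affine_map_scale_add)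
  let ?f = "cevian_map A B C P \<circ> inv (complement A B C) \<circ> cevian_map A B C (isotomic A B C P)"
  let ?N = "(q + r) * (r + p) * (p + q)"
  define w where "w = (p * (q + r)\<^sup>2 / ?N) *\<^sub>R A + (q * (r + p)\<^sup>2 / ?N) *\<^sub>R B + (r * (p + q)\<^sup>2 / ?N) *\<^sub>R C"
  have N: "?N \<noteq> 0" using pqr by simp
  have k: "- 4 * p * q * r \<noteq> 0" and x: "p * (q + r)\<^sup>2 \<noteq> 0" using pqr by simp_all
  have sum: "?N - - 4 * p * q * r = p * (q + r)\<^sup>2 + q * (r + p)\<^sup>2 + r * (p + q)\<^sup>2"
    by (simp add: algebra_simps power2_eq_square)
  have fA: "?f A = (- 4 * p * q * r / ?N) *\<^sub>R A + w"
    using cevian_composition_complement_vertex[OF adm T]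
    by (simp only: w_def o_apply T' ac_simps)
  have fB: "?f B = (- 4 * p * q * r / ?N) *\<^sub>R B + w"
    using cevian_composition_complement_vertex[OF admissible_rotate[OF adm] T(1,3,4,2)]
    by (simp only: w_def o_apply T' complement_rotate[of C A B] complement_rotate[of B C A] ac_simps)
  have fC: "?f C = (- 4 * p * q * r / ?N) *\<^sub>R C + w"
    using cevian_composition_complement_vertex[OF admissible_rotate[OF admissible_rotate[OF adm]] T(1,4,2,3)]
    by (simp only: w_def o_apply T' complement_rotate[of C A B] complement_rotate[of B C A] ac_simps)
  show ?thesis
    by (rule center_barycentric[OF nc affine_map_comp[OF affine_map_comp[OF T(1) K] T'(1)] k N x sum w_def fA fB fC])
qed

section \<open>The generalized isogonal map through delta, and the two centers\<close>

theorem proposition2p4: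
  fixes A B C :: plane and P :: xset
  assumes "\<not> collinear {A, B, C}"
    and "xpoint P"
    and "\<not> on_sides A B C P"
    and "\<not> on_anticomplementary_sides A B C P"
  shows "(\<forall>Y. xpoint Y \<and> \<not> on_sides A B C Y \<longrightarrow>
            gamma A B C P Y = (delta A B C P \<circ> isotomic A B C \<circ> delta A B C P) Y) \<and>
         (let K = complement A B C;
              P' = isotomic A B C P;
              Q' = ext K P;
              T_P = cevian_map A B C P;
              T_P' = cevian_map A B C P';
              X = center (T_P \<circ> T_P');
              S = center (T_P \<circ> inv K \<circ> T_P')
          in gamma A B C P X = Q' \<and> delta A B C P S = isotomic A B C Q')"
proof -
  note nc = assms(1)
  obtain p q r where P: "P = barycentric A B C p q r" and adm: "admissible p q r"
    using admissible_coordinates[OF assms] .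
  note pqr = adm[unfolded admissible_def]
  have "gamma A B C P Y = (delta A B C P \<circ> isotomic A B C \<circ> delta A B C P) Y"
    if Y: "xpoint Y" "\<not> on_sides A B C Y" for Y
  proof -
    obtain x y z where Yb: "Y = barycentric A B C x y z" by (rule xpoint_barycentric[OF nc Y(1)])
    with Y(2) have "x \<noteq> 0" "y \<noteq> 0" "z \<noteq> 0" by (simp_all add: on_sides_barycentric[OF nc])
    then show ?thesis
      using pqr by (simp add: P Yb gamma_barycentric[OF nc adm] delta_barycentric[OF nc adm]
          isotomic_barycentric[OF nc] power2_eq_square)
  qed
  moreover have "gamma A B C P (center (cevian_map A B C P \<circ> cevian_map A B C (isotomic A B C P))) =
      ext (complement A B C) P"
    unfolding P center_cevian_composition[OF nc adm] ext_complement_barycentric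
    using pqr by (simp add: gamma_barycentric[OF nc adm] power2_eq_square)
  moreover have "delta A B C P (center (cevian_map A B C P \<circ> inv (complement A B C) \<circ> cevian_map A B C (isotomic A B C P))) =
      isotomic A B C (ext (complement A B C) P)"
    unfolding P center_cevian_complement_composition[OF nc adm] ext_complement_barycentric
    using pqr by (simp add: delta_barycentric[OF nc adm] isotomic_barycentric[OF nc] power2_eq_square)
  ultimately show ?thesis by (simp add: Let_def)
qed

end
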